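(* Let $m<n$ be positive integers, let $g=(g_1,\dots,g_m):\mathbb{R}^n\to\mathbb{R}^m$ be smooth, let $\mathcal{M}=\{u\in\mathbb{R}^n : g(u)=0\}$, and assume that the Jacobian $\mathrm{D}g(u)$ has full rank $m$ for every $u\in\mathcal{M}$. Let $\bar f:\mathbb{R}^n\to\mathbb{R}^n$ be a smooth vector field. Let $T\in(0,\infty]$ and let $u:[0,T)\to\mathbb{R}^n$ be a solution of the projected differential equation $$\dot u(t)=\mathrm{Proj}_{u(t)}\bigl(\bar f(u(t))\bigr),\qquad u(0)=u_0,$$ with $u_0\in\mathcal{M}$. Then $g(u(t))=0$ for all $t\in[0,T)$.
   Context: $\mathbb{R}^n$ carries the standard Euclidean inner product. For $u\in\mathbb{R}^n$, $\mathrm{D}g(u):\mathbb{R}^n\to\mathbb{R}^m$ is the differential of $g$ at $u$, $\mathrm{D}g(u)[v]=(\langle\nabla g_1(u),v\rangle,\dots,\langle\nabla g_m(u),v\rangle)$, and $\mathrm{D}g(u)^*:\mathbb{R}^m\to\mathbb{R}^n$ is its adjoint, $\mathrm{D}g(u)^*[\alpha]=\sum_{i=1}^m\alpha_i\nabla g_i(u)$. The projection operator is $$\mathrm{Proj}_u(v)=v-\mathrm{D}g(u)^*\bigl[(\mathrm{D}g(u)^* )^{\dagger}[v]\bigr],\qquad v\in\mathbb{R}^n,$$ where $(\cdot)^\dagger$ denotes the Moore--Penrose pseudoinverse. For $u\in\mathcal{M}$ this is the orthogonal projection of $\mathbb{R}^n$ onto the tangent space $\mathrm{T}_u\mathcal{M}=\ker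 \mathrm{D}g(u)$; with $G=\mathrm{D}g(u)$ written as an $m\times n$ matrix of full row rank it equals $\mathrm{Proj}_u(v)=\bigl(I-G^\top(GG^\top)^{-1}G\bigr)v$. *)

theory Defs
  imports "HOL-Analysis.Analysis"
begin

text \<open>Between Euclidean spaces, existence and continuity of all iterated directional derivatives
  is the same as \<open>k\<close>-fold continuous Frechet differentiability; recursing on directional derivatives
  keeps the type of the function fixed.\<close>

primrec Ck :: "nat \<Rightarrow> ('a::euclidean_space \<Rightarrow> 'b::euclidean_space) \<Rightarrow> bool" where
  "Ck 0 f \<longleftrightarrow> continuous_on UNIV f"
| "Ck (Suc k) f \<longleftrightarrow>
     (\<forall>x. f differentiable at x) \<and> (\<forall>v. Ck k (\<lambda>x. frechet_derivative f (at x) v))"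

definition smooth :: "('a::euclidean_space \<Rightarrow> 'b::euclidean_space) \<Rightarrow> bool" where
  "smooth f \<longleftrightarrow> (\<forall>k. Ck k f)"

definition penrose ::
  "('a::euclidean_space \<Rightarrow> 'b::euclidean_space) \<Rightarrow> ('b \<Rightarrow> 'a) \<Rightarrow> bool" where
  "penrose A X \<longleftrightarrow> linear X \<and>
     A \<circ> X \<circ> A = A \<and> X \<circ> A \<circ> X = X \<and>
     adjoint (A \<circ> X) = A \<circ> X \<and> adjoint (X \<circ> A) = X \<circ> A"

definition pinv :: "('a::euclidean_space \<Rightarrow> 'b::euclidean_space) \<Rightarrow> 'b \<Rightarrow> 'a" where
  "pinv A = (THE X. penrose A X)"

lemma penrose_unique:
  assumes A: "linear A" and X: "penrose A X" and Y: "penrose A Y"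
  shows "X = Y"
proof -
  have sym1: "A (Z y) \<bullet> z = y \<bullet> A (Z z)" if "penrose A Z" for Z y z
  proof -
    have "linear (A \<circ> Z)" using that A linear_compose unfolding penrose_def by blast
    from adjoint_works[OF this, of y z] show ?thesis
      using that by (simp add: penrose_def)
  qed
  have sym2: "Z (A y) \<bullet> z = y \<bullet> Z (A z)" if "penrose A Z" for Z y z
  proof -
    have "linear (Z \<circ> A)" using that A linear_compose unfolding penrose_def by blast
    from adjoint_works[OF this, of y z] show ?thesis
      using that by (simp add: penrose_def)
  qed
  have aza: "A (Z (A x)) = A x" and zaz: "Z (A (Z y)) = Z y" if "penrose A Z" for Z x y
    using that unfolding penrose_def by (auto simp: fun_eq_iff)
  have 1: "A (X y) = A (Y y)" for y
  proof (rule vector_eq_rdot[THEN iffD1], rule allI)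
    fix z
    have "A (X y) \<bullet> z = A (Y (A (X y))) \<bullet> z" by (simp add: aza[OF Y])
    also have "\<dots> = A (X y) \<bullet> A (Y z)" by (rule sym1[OF Y])
    also have "\<dots> = y \<bullet> A (X (A (Y z)))" by (rule sym1[OF X])
    also have "\<dots> = A (Y y) \<bullet> z" by (simp add: aza[OF X] sym1[OF Y])
    finally show "A (X y) \<bullet> z = A (Y y) \<bullet> z" .
  qed
  have 2: "X (A y) = Y (A y)" for y
  proof (rule vector_eq_rdot[THEN iffD1], rule allI)
    fix z
    have "X (A y) \<bullet> z = X (A (Y (A y))) \<bullet> z" by (simp add: aza[OF Y])
    also have "\<dots> = Y (A y) \<bullet> X (A z)" by (rule sym2[OF X])
    also have "\<dots> = y \<bullet> Y (A (X (A z)))" by (rule sym2[OF Y])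
    also have "\<dots> = Y (A y) \<bullet> z" by (simp add: aza[OF X] sym2[OF Y])
    finally show "X (A y) \<bullet> z = Y (A y) \<bullet> z" .
  qed
  show ?thesis
  proof (rule ext)
    fix y
    have "X y = X (A (X y))" by (simp add: zaz[OF X])
    also have "\<dots> = Y (A (Y y))" by (simp only: 1 2)
    also have "\<dots> = Y y" by (simp add: zaz[OF Y])
    finally show "X y = Y y" .
  qed
qed

lemma penrose_exists:
  fixes A :: "'a::euclidean_space \<Rightarrow> 'b::euclidean_space"
  assumes A: "linear A"
  shows "\<exists>X. penrose A X"
proof -
  define P where "P y x \<longleftrightarrow> (\<forall>k. A k = 0 \<longrightarrow> x \<bullet> k = 0) \<and> (\<forall>z. (y - A x) \<bullet> A z = 0)" for y x
  have ex: "\<exists>x. P y x" for y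
  proof -
    have sr: "span (range A) = range A"
      by (rule span_eq_iff[THEN iffD2, OF linear_subspace_image[OF A subspace_UNIV]])
    obtain p q where pq: "p \<in> span (range A)" "\<And>w. w \<in> span (range A) \<Longrightarrow> orthogonal q w" "y = p + q"
      using orthogonal_subspace_decomp_exists[of "range A" y] by blast
    obtain w where w: "p = A w" using pq(1) unfolding sr by blast
    let ?K = "{k. A k = 0}"
    have sk: "span ?K = ?K"
      by (rule span_eq_iff[THEN iffD2, OF linear_subspace_kernel[OF A]])
    obtain a b where ab: "a \<in> span ?K" "\<And>v. v \<in> span ?K \<Longrightarrow> orthogonal b v" "w = a + b"
      using orthogonal_subspace_decomp_exists[of ?K w] by blast
    have "A b = p" using ab w sk linear_add[OF A, of a b] by auto
    then have "P y b"
      using ab pq sk sr unfolding P_def by (auto simp: orthogonal_def)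
    then show ?thesis ..
  qed
  have un: "x = x'" if "P y x" "P y x'" for y x x'
  proof -
    have "(A x - A x') \<bullet> A z = 0" for z
    proof -
      have "(y - A x) \<bullet> A z = 0" "(y - A x') \<bullet> A z = 0"
        using that unfolding P_def by auto
      then show ?thesis by (simp add: inner_diff_left)
    qed
    from this[of "x - x'"] have "A (x - x') = 0" by (simp add: linear_diff[OF A])
    then have "x \<bullet> (x - x') = 0" "x' \<bullet> (x - x') = 0"
      using that unfolding P_def by blast+
    then have "(x - x') \<bullet> (x - x') = 0"
      by (simp add: inner_diff_left)
    then show ?thesis by simp
  qed
  obtain X where X: "P y (X y)" for y using ex by metis
  have Xk: "A k = 0 \<Longrightarrow> X y \<bullet> k = 0" and Xr: "(y - A (X y)) \<bullet> A z = 0" for y k z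
    using X unfolding P_def by auto
  have lin: "linear X"
  proof (rule linearI)
    fix y y' c
    have "P (y + y') (X y + X y')"
      using X[of y] X[of y'] unfolding P_def
      by (simp add: linear_add[OF A] inner_add_left add_diff_add)
    with X un show "X (y + y') = X y + X y'" by blast
    have "P (c *\<^sub>R y) (c *\<^sub>R X y)"
      using X[of y] unfolding P_def
      by (simp add: linear_scale[OF A] flip: scaleR_diff_right)
    with X un show "X (c *\<^sub>R y) = c *\<^sub>R X y" by blast
  qed
  have aza: "A (X (A z)) = A z" for z
  proof -
    have "(A z - A (X (A z))) \<bullet> A (z - X (A z)) = 0" by (rule Xr)
    then show ?thesis by (simp add: linear_diff[OF A])
  qed
  have xax: "X (A (X y)) = X y" for y
  proof -
    have "P (A (X y)) (X y)" using Xk unfolding P_def by simp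
    with X un show ?thesis by blast
  qed
  have s1: "A (X y) \<bullet> z = A (X y) \<bullet> A (X z)" for y z
    using Xr[of z "X y"] unfolding inner_diff_left by (simp add: inner_commute)
  have s2: "X (A y) \<bullet> z = X (A y) \<bullet> X (A z)" for y z
    using Xk[of "z - X (A z)" "A y"] by (simp add: linear_diff[OF A] aza inner_diff_right)
  have t1: "A (X y) \<bullet> z = y \<bullet> A (X z)" for y z
    using s1[of y z] s1[of z y] by (simp add: inner_commute)
  have t2: "X (A y) \<bullet> z = y \<bullet> X (A z)" for y z
    using s2[of y z] s2[of z y] by (simp add: inner_commute)
  have "adjoint (A \<circ> X) = A \<circ> X" "adjoint (X \<circ> A) = X \<circ> A"
    by (auto intro!: adjoint_unique simp: t1 t2)
  then have "penrose A X"
    using lin unfolding penrose_def by (auto simp: fun_eq_iff aza xax)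
  then show ?thesis by (rule exI[of _ X])
qed

lemma penrose_pinv:
  assumes A: "linear A"
  shows "penrose A (pinv A)"
proof -
  obtain X where X: "penrose A X"
    by (rule exE[OF penrose_exists[OF A]])
  show ?thesis
    unfolding pinv_def by (rule theI[where P = "penrose A", OF X]) (rule penrose_unique[OF A _ X])
qed

definition Proj ::
  "('a::euclidean_space \<Rightarrow> 'b::euclidean_space) \<Rightarrow> 'a \<Rightarrow> 'a \<Rightarrow> 'a" where
  "Proj g u v =
     (let Dg = frechet_derivative g (at u) in v - adjoint Dg (pinv (adjoint Dg) v))"

end

theory Submission
  imports Defs
begin

text \<open>For every linear map \<open>D\<close>, \<open>D\<^sup>* (D\<^sup>*)\<^sup>\<dagger>\<close> is the orthogonal projection
  onto the range of \<open>D\<^sup>*\<close>, that is onto the orthogonal complement of \<open>ker D\<close>. So the projected field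
  is always annihilated by the differential of \<open>g\<close>, and \<open>g\<close> is constant along solutions.\<close>

lemma linear_adjoint_pinv_adjoint:
  fixes D :: "'a::euclidean_space \<Rightarrow> 'b::euclidean_space"
  assumes D: "linear D"
  shows "D (adjoint D (pinv (adjoint D) v)) = D v"
proof (rule vector_eq_rdot[THEN iffD1], rule allI)
  fix z
  let ?A = "adjoint D"
  let ?X = "pinv ?A"
  have A: "linear ?A"
    using D by (rule adjoint_linear)
  have pen: "penrose ?A ?X"
    using A by (rule penrose_pinv)
  have AX: "linear (?A \<circ> ?X)"
    using pen A linear_compose unfolding penrose_def by blast
  have sym: "?A (?X v) \<bullet> w = v \<bullet> ?A (?X w)" for w
    using adjoint_works[OF AX, of v w] pen by (simp add: penrose_def)
  have AXA: "?A (?X (?A z)) = ?A z"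
    using pen by (simp add: penrose_def fun_eq_iff)
  \<comment> \<open>\<open>D\<close> crosses the inner product as \<open>?A\<close>. Being
    self-adjoint, \<open>?A \<circ> ?X\<close> can then be moved onto \<open>?A z\<close>, which it
    fixes by \<open>AXA\<close>.\<close>
  have "D (?A (?X v)) \<bullet> z = ?A (?X v) \<bullet> ?A z"
    using adjoint_works[OF D, of "?A (?X v)" z] by (simp add: inner_commute)
  also have "\<dots> = v \<bullet> ?A z"
    by (simp add: sym AXA)
  also have "\<dots> = D v \<bullet> z"
    using adjoint_works[OF D, of v z] by (simp add: inner_commute)
  finally show "D (?A (?X v)) \<bullet> z = D v \<bullet> z" .
qed

lemma frechet_derivative_Proj:
  assumes "g differentiable at x"
  shows "frechet_derivative g (at x) (Proj g x v) = 0"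
  using linear_frechet_derivative[OF assms]
  by (simp add: Proj_def Let_def linear_diff linear_adjoint_pinv_adjoint)

lemma smooth_differentiable:
  assumes "smooth g"
  shows "g differentiable at x"
proof -
  have "Ck (Suc 0) g"
    using assms unfolding smooth_def by blast
  then show ?thesis
    by simp
qed

theorem proposition1:
  fixes g :: "real ^ 'n \<Rightarrow> real ^ 'm"
    and f :: "real ^ 'n \<Rightarrow> real ^ 'n"
    and M :: "(real ^ 'n) set"
    and u :: "real \<Rightarrow> real ^ 'n"
    and u0 :: "real ^ 'n"
    and T :: ereal
  assumes "CARD('m) < CARD('n)"
    and "smooth g"
    and "M = {x. g x = 0}"
    and "\<And>x. x \<in> M \<Longrightarrow> rank (jacobian g (at x)) = CARD('m)"
    and "smooth f"
    and "0 < T"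
    and "\<And>t. 0 \<le> t \<Longrightarrow> ereal t < T \<Longrightarrow>
           (u has_vector_derivative Proj g (u t) (f (u t))) (at t within {s. 0 \<le> s \<and> ereal s < T})"
    and "u 0 = u0"
    and "u0 \<in> M"
  shows "\<forall>t. 0 \<le> t \<and> ereal t < T \<longrightarrow> g (u t) = 0"
proof (intro allI impI)
  fix t :: real
  assume t: "0 \<le> t \<and> ereal t < T"
  let ?S = "{s. 0 \<le> s \<and> ereal s < T}"
  \<comment> \<open>The projected field is annihilated at every point of the space, so there is no
    circularity in not yet knowing that \<open>u s\<close> lies in \<open>M\<close>. The derivative
    within \<open>?S\<close> is one-sided at 0.\<close>
  have "((\<lambda>s. g (u s)) has_derivative (\<lambda>h. 0)) (at s within ?S)" if s: "s \<in> ?S" for s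
  proof -
    let ?v = "Proj g (u s) (f (u s))"
    have d: "g differentiable at (u s)"
      using assms(2) by (rule smooth_differentiable)
    have "(u has_derivative (\<lambda>h. h *\<^sub>R ?v)) (at s within ?S)"
      using assms(7)[of s] s by (simp add: has_vector_derivative_def)
    \<comment> \<open>By the chain rule the derivative sends \<open>h\<close> to the differential of
      \<open>g\<close> at \<open>h *\<^sub>R ?v\<close>; linearity pulls out \<open>h\<close> and
      leaves the zero value at \<open>?v\<close>.\<close>
    from has_derivative_compose[OF this frechet_derivative_works[THEN iffD1, OF d]]
    show ?thesis
      by (simp add: linear_scale[OF linear_frechet_derivative[OF d]] frechet_derivative_Proj[OF d])
  qed
  \<comment> \<open>A vanishing derivative forces constancy on a convex set; \<open>?S\<close> is an
    interval also when \<open>T\<close> is infinite.\<close>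
  moreover have "convex ?S"
    unfolding is_interval_convex_1[symmetric] is_interval_1
    by (auto intro: le_less_trans[OF ereal_less_eq(3)[THEN iffD2]])
  \<comment> \<open>The initial time lies in \<open>?S\<close>, so the constant is
    \<open>g u0\<close>.\<close>
  moreover have "0 \<in> ?S"
    using assms(6) by (simp flip: zero_ereal_def)
  ultimately obtain c where c: "\<And>s. s \<in> ?S \<Longrightarrow> g (u s) = c"
    using has_derivative_zero_constant[of ?S "\<lambda>s. g (u s)"] by auto
  have "g (u t) = g (u 0)"
    using c t \<open>0 \<in> ?S\<close> by simp
  also have "\<dots> = 0"
    using assms(3,8,9) by simp
  finally show "g (u t) = 0" .
qed

end
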